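(* For each integer $n\ge 0$, $$\widetilde{\sigma}_{5}(n)=-48\sum_{\substack{i,j\ge 0\\ i+j=n}}\widehat{\sigma}(i)\,\widetilde{\sigma}_{3}(j),$$ where $\widetilde{\sigma}_{5}(0)=\tfrac18$, $\widehat{\sigma}(0)=\tfrac1{24}$ and $\widetilde{\sigma}_{3}(0)=-\tfrac1{16}$.
   Context: For integers $n\ge1$, $\widetilde{\sigma}_{s}(n)=\sum_{d\mid n}(-1)^{d-1}d^{s}$ and $\widehat{\sigma}(n)=\widehat{\sigma}_{1}(n)=\sum_{d\mid n}(-1)^{n/d-1}d$. Values at $n=0$ are assigned as in the claim. *)

theory Defs
  imports Complex_Main
begin

text \<open>
  Both functions are meant for \<open>n \<ge> 1\<close>, where every divisor is positive and the
  subtractions in the exponents do not truncate. At \<open>n = 0\<close> the index set is infinite and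
  the sum takes the junk value 0; the values at 0 are assigned separately, by function update.
\<close>

definition sigma_tilde :: "nat \<Rightarrow> nat \<Rightarrow> real" where
  "sigma_tilde s n = (\<Sum>d | d dvd n. (-1) ^ (d - 1) * real d ^ s)"

definition sigma_hat :: "nat \<Rightarrow> nat \<Rightarrow> real" where
  "sigma_hat s n = (\<Sum>d | d dvd n. (-1) ^ (n div d - 1) * real d ^ s)"

end

theory Submission
  imports Defs
begin

text \<open>
  Both sides are sums over divisors, and the convolution becomes a sum of
  \<open>(-1)^(b + x) * a * b^3\<close> over the positive solutions of \<open>a * x + b * y = n\<close>. As in Liouville's
  method, \<open>(a, b, x, y) \<mapsto> (a - b, b, x, x + y)\<close> maps the solutions with \<open>b < a\<close> bijectively to
  those with \<open>x < y\<close>. It permutes the characters \<open>(-1)^(b + x)\<close>, \<open>(-1)^(a + y)\<close> and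
  \<open>(-1)^(a + b + x + y)\<close>. For a suitable combination \<open>U\<close> of them, symmetric under exchanging
  \<open>(a, x)\<close> with \<open>(b, y)\<close>, the change of \<open>U\<close> along this map is \<open>-8\<close> times the symmetrised
  summand. Comparing the sums of \<open>U\<close> over both halves leaves only the diagonals
  \<open>a = b\<close> and \<open>x = y\<close>, where the sums are elementary.
\<close>

section \<open>Solutions of \<open>a * x + b * y = n\<close> in positive integers and their
  symmetries\<close>

definition sols :: "nat \<Rightarrow> (nat \<times> nat \<times> nat \<times> nat) set" where
  "sols n = {(a, b, x, y). 0 < a \<and> 0 < b \<and> 0 < x \<and> 0 < y \<and> a * x + b * y = n}"

lemma finite_sols: "finite (sols n)"
proof (rule finite_subset)
  have "u \<le> u * v + w" "v \<le> u * v + w" "u \<le> w + u * v" "v \<le> w + u * v"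
    if "0 < u" "0 < v" for u v w :: nat
    using that by (simp_all add: trans_le_add1 trans_le_add2)
  then show "sols n \<subseteq> {..n} \<times> {..n} \<times> {..n} \<times> {..n}"
    by (auto simp: sols_def)
qed simp

lemma sum_sols_exchange:
  "(\<Sum>(a, b, x, y) \<in> {(a, b, x, y) \<in> sols n. P a b x y}. f a b x y) =
   (\<Sum>(a, b, x, y) \<in> {(a, b, x, y) \<in> sols n. P b a y x}. f b a y x)"
  by (rule sum.reindex_bij_witness
      [where i = "\<lambda>(a, b, x, y). (b, a, y, x)" and j = "\<lambda>(a, b, x, y). (b, a, y, x)"])
    (auto simp: sols_def)

lemma sum_sols_transpose:
  "(\<Sum>(a, b, x, y) \<in> {(a, b, x, y) \<in> sols n. P a b x y}. f a b x y) =
   (\<Sum>(a, b, x, y) \<in> {(a, b, x, y) \<in> sols n. P x y a b}. f x y a b)"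
  by (rule sum.reindex_bij_witness
      [where i = "\<lambda>(a, b, x, y). (x, y, a, b)" and j = "\<lambda>(a, b, x, y). (x, y, a, b)"])
    (auto simp: sols_def mult.commute)

text \<open>The equation survives because \<open>(a - b) * x + b * (x + y) = a * x + b * y\<close>;
  the condition \<open>b < a\<close> keeps the new first entry positive and corresponds to
  \<open>x < x + y\<close>.\<close>

lemma sum_sols_shear:
  "(\<Sum>(a, b, x, y) \<in> {(a, b, x, y) \<in> sols n. x < y}. f a b x y) =
   (\<Sum>(a, b, x, y) \<in> {(a, b, x, y) \<in> sols n. b < a}. f (a - b) b x (x + y))"
proof (rule sum.reindex_bij_witness
      [where i = "\<lambda>(a, b, x, y). (a - b, b, x, x + y)"
        and j = "\<lambda>(a, b, x, y). (a + b, b, x, y - x)"], goal_cases)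
  case (2 q)
  obtain a b x y where "q = (a, b, x, y)" by (cases q)
  moreover from this 2 have "b * y = b * x + b * (y - x)"
    by (metis (no_types, lifting) add_mult_distrib2 case_prodD le_add_diff_inverse
        less_imp_le mem_Collect_eq)
  ultimately show ?case
    using 2 by (auto simp: sols_def algebra_simps)
next
  case (4 q)
  obtain a b x y where "q = (a, b, x, y)" by (cases q)
  moreover from this 4 have "a * x = (a - b) * x + b * x"
    by (metis (no_types, lifting) add_mult_distrib case_prodD le_add_diff_inverse2
        less_imp_le mem_Collect_eq)
  ultimately show ?case
    using 4 by (auto simp: sols_def algebra_simps)
qed auto

text \<open>With \<open>a = b = d\<close> the equation reads \<open>d * (x + y) = n\<close>, so
  \<open>d\<close> is a divisor and \<open>x\<close> runs freely below the codivisor.\<close>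

lemma sum_sols_diag:
  assumes "0 < n"
  shows "(\<Sum>(a, b, x, y) \<in> {(a, b, x, y) \<in> sols n. a = b}. f a b x y) =
    (\<Sum>d | d dvd n. \<Sum>x = 1..<n div d. f d d x (n div d - x))"
proof -
  have "(\<Sum>d | d dvd n. \<Sum>x = 1..<n div d. f d d x (n div d - x)) =
    (\<Sum>(d, x) \<in> Sigma {d. d dvd n} (\<lambda>d. {1..<n div d}). f d d x (n div d - x))"
    using assms by (subst sum.Sigma) auto
  also have "\<dots> = (\<Sum>(a, b, x, y) \<in> {(a, b, x, y) \<in> sols n. a = b}. f a b x y)"
  proof (rule sum.reindex_bij_witness
      [where i = "\<lambda>(a, b, x, y). (a, x)" and j = "\<lambda>(d, x). (d, d, x, n div d - x)"], goal_cases)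
    case (2 q)
    then show ?case
      using assms by (auto simp: sols_def simp flip: add_mult_distrib2 elim: dvdE)
  next
    case (3 q)
    then show ?case
      by (auto simp: sols_def simp flip: add_mult_distrib2)
  next
    case (4 q)
    then show ?case
      by (auto simp: sols_def simp flip: add_mult_distrib2)
  qed auto
  finally show ?thesis by simp
qed

text \<open>The part with \<open>a < b\<close> is folded onto \<open>b < a\<close> by exchanging the
  two products.\<close>

lemma sum_sols_split:
  fixes f :: "nat \<Rightarrow> nat \<Rightarrow> nat \<Rightarrow> nat \<Rightarrow> 'a :: comm_monoid_add"
  shows "(\<Sum>(a, b, x, y) \<in> sols n. f a b x y) =
    (\<Sum>(a, b, x, y) \<in> {(a, b, x, y) \<in> sols n. b < a}. f a b x y + f b a y x) +
    (\<Sum>(a, b, x, y) \<in> {(a, b, x, y) \<in> sols n. a = b}. f a b x y)"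
proof -
  let ?L = "{(a, b, x, y) \<in> sols n. b < a}" and ?G = "{(a, b, x, y) \<in> sols n. a < b}"
    and ?D = "{(a, b, x, y) \<in> sols n. a = b}"
  have fin: "finite ?L" "finite ?G" "finite ?D"
    by (auto intro: finite_subset[OF _ finite_sols[of n]])
  have "sols n = (?L \<union> ?G) \<union> ?D" by auto
  then have "(\<Sum>(a, b, x, y) \<in> sols n. f a b x y) =
      (\<Sum>(a, b, x, y) \<in> (?L \<union> ?G) \<union> ?D. f a b x y)"
    by (rule arg_cong)
  also have "\<dots> = (\<Sum>(a, b, x, y) \<in> ?L. f a b x y) + (\<Sum>(a, b, x, y) \<in> ?G. f a b x y)
      + (\<Sum>(a, b, x, y) \<in> ?D. f a b x y)"
    using fin by (subst sum.union_disjoint, simp, simp, fastforce,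
        subst sum.union_disjoint, simp, simp, fastforce, simp)
  also have "(\<Sum>(a, b, x, y) \<in> ?G. f a b x y) = (\<Sum>(a, b, x, y) \<in> ?L. f b a y x)"
    by (rule sum_sols_exchange)
  finally show ?thesis
    by (simp add: sum.distrib case_prod_unfold)
qed

lemma convolution_divisor_sums:
  fixes f g :: "nat \<Rightarrow> nat \<Rightarrow> 'a :: comm_semiring_0"
  shows "(\<Sum>(i, j) \<in> {(i, j). i + j = n \<and> 0 < i \<and> 0 < j}.
      (\<Sum>d | d dvd i. f d (i div d)) * (\<Sum>d | d dvd j. g d (j div d))) =
    (\<Sum>(a, b, x, y) \<in> sols n. f a x * g b y)"
proof -
  let ?I = "{(i, j). i + j = n \<and> 0 < i \<and> 0 < j}"
  have fin: "finite ?I"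
    by (rule finite_subset[of _ "{..n} \<times> {..n}"]) auto
  have "(\<Sum>(i, j) \<in> ?I. (\<Sum>d | d dvd i. f d (i div d)) * (\<Sum>d | d dvd j. g d (j div d))) =
    (\<Sum>p \<in> ?I. \<Sum>q \<in> {d. d dvd fst p} \<times> {d. d dvd snd p}.
      f (fst q) (fst p div fst q) * g (snd q) (snd p div snd q))"
    by (rule sum.cong) (auto simp: sum_product sum.cartesian_product case_prod_unfold)
  also have "\<dots> = (\<Sum>(p, q) \<in> Sigma ?I (\<lambda>p. {d. d dvd fst p} \<times> {d. d dvd snd p}).
      f (fst q) (fst p div fst q) * g (snd q) (snd p div snd q))"
    by (rule sum.Sigma) (use fin in auto)
  also have "\<dots> = (\<Sum>(a, b, x, y) \<in> sols n. f a x * g b y)"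
    by (rule sum.reindex_bij_witness
      [where i = "\<lambda>(a, b, x, y). ((a * x, b * y), (a, b))"
        and j = "\<lambda>((i, j), (a, b)). (a, b, i div a, j div b)"])
      (auto simp: sols_def elim: dvdE)
  finally show ?thesis .
qed

section \<open>Elementary sums for the diagonals\<close>

lemma sum_alternating:
  "(\<Sum>x = 1..<m. (-1) ^ x :: real) = - (1 + (-1) ^ m) / 2" if "0 < m"
  using that by (induction m rule: nat_induct_non_zero) (auto simp: field_simps)

lemma sum_square_centred:
  "(\<Sum>b = 1..<d. (real d - 2 * real b) ^ 2) = real d * (real d - 1) * (real d - 2) / 3"
  if "0 < d"
proof -
  \<comment> \<open>The parameter \<open>t\<close> is separated from the upper limit
    \<open>k\<close>; with \<open>d\<close> in both roles the induction would change the
    summand.\<close>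
  have "(\<Sum>b = 1..<k. (t - 2 * real b) ^ 2) =
      (real k - 1) * t\<^sup>2 - 2 * real k * (real k - 1) * t
      + 2 * real k * (real k - 1) * (2 * real k - 1) / 3" if "0 < k" for k :: nat and t :: real
    using that
    by (induction k rule: nat_induct_non_zero) (auto simp: field_simps power2_eq_square)
  from this[OF that, of d] show ?thesis
    by (simp add: field_simps power2_eq_square)
qed

text \<open>For \<open>a + b = d\<close> the factor \<open>b + 2 * a\<close> in
  \<open>weight\<close> is \<open>2 * d - b\<close>, which gives this summand.\<close>

lemma sum_alternating_quartic:
  "(\<Sum>b = 1..<d. (-1) ^ b * real b ^ 2 * (2 * real d - real b) ^ 2) =
    - (real d + (-1) ^ d * real d ^ 4) / 2" if "0 < d"
proof -
  \<comment> \<open>an explicit antidifference, found by undetermined coefficients\<close>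
  have "(\<Sum>b = 1..<k. (-1) ^ b * real b ^ 2 * (2 * t - real b) ^ 2) =
      (-1) ^ Suc k * (real k ^ 4 / 2 - real k ^ 3 + real k / 2
        - 4 * t * (real k ^ 3 / 2 - 3 * real k ^ 2 / 4 + 1 / 8)
        + 4 * t ^ 2 * (real k ^ 2 / 2 - real k / 2)) - t / 2"
    if "0 < k" for k :: nat and t :: real
    using that
    by (induction k rule: nat_induct_non_zero)
      (auto simp: field_simps power2_eq_square power3_eq_cube power4_eq_xxxx)
  from this[OF that, of d] show ?thesis
    by (simp add: field_simps power2_eq_square power3_eq_cube power4_eq_xxxx)
qed

text \<open>The function \<open>U\<close> above; its polynomial coefficients solve the equation in \<open>weight_shear\<close>.\<close>

definition weight :: "nat \<Rightarrow> nat \<Rightarrow> nat \<Rightarrow> nat \<Rightarrow> real" where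
  "weight a b x y = (-1) ^ (b + x) * (real b * (real b + 2 * real a)) ^ 2
    + (-1) ^ (a + y) * (real a * (real a + 2 * real b)) ^ 2
    + (-1) ^ (a + b + x + y) * (real a ^ 2 - real b ^ 2) ^ 2"

lemma weight_exchange: "weight b a y x = weight a b x y"
  by (simp add: weight_def add_ac power2_commute)

text \<open>The map fixes the first character and swaps the other two. The new second coefficient is
  the old third one, since \<open>(a - b) * (a + b) = a^2 - b^2\<close>. The rest is
  \<open>b^2 * ((2*a - b)^2 - (2*a + b)^2) = -8 * a * b^3\<close> and its mirror image
  \<open>a^2 * ((a - 2*b)^2 - (a + 2*b)^2) = -8 * a^3 * b\<close>.\<close>

lemma weight_shear:
  assumes "b < a"
  shows "weight (a - b) b x (x + y) = weight a b x y
    - 8 * ((-1) ^ (b + x) * real a * real b ^ 3 + (-1) ^ (a + y) * real b * real a ^ 3)"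
proof -
  obtain c where a: "a = b + c" using assms less_imp_add_positive by blast
  show ?thesis
    unfolding a weight_def
    by (cases "even b"; cases "even c"; cases "even x"; cases "even y")
      (simp_all add: algebra_simps power2_eq_square power3_eq_cube)
qed

lemma sum_sols_signed_cube:
  assumes n: "0 < n"
  shows "16 * (\<Sum>(a, b, x, y) \<in> sols n. (-1) ^ (b + x) * real a * real b ^ 3) =
    (\<Sum>d | d dvd n. (-1) ^ d * real d ^ 5 / 3 + 2 * (-1) ^ d * real d ^ 3 / 3
      - (-1) ^ (n div d) * real d)"
proof -
  define S where "S = (\<Sum>(a, b, x, y) \<in> sols n. (-1) ^ (b + x) * real a * real b ^ 3)"
  define A where "A = (\<Sum>(a, b, x, y) \<in> {(a, b, x, y) \<in> sols n. b < a}. weight a b x y)"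
  define B where "B = (\<Sum>(a, b, x, y) \<in> {(a, b, x, y) \<in> sols n. x < y}. weight a b x y)"
  define C where "C = (\<Sum>(a, b, x, y) \<in> {(a, b, x, y) \<in> sols n. b < a}.
    (-1) ^ (b + x) * real a * real b ^ 3 + (-1) ^ (a + y) * real b * real a ^ 3)"
  define D where "D = (\<Sum>(a, b, x, y) \<in> {(a, b, x, y) \<in> sols n. a = b}. weight a b x y)"
  define E where "E = (\<Sum>(a, b, x, y) \<in> {(a, b, x, y) \<in> sols n. x = y}. weight a b x y)"
  define F where "F = (\<Sum>(a, b, x, y) \<in> {(a, b, x, y) \<in> sols n. a = b}.
    (-1) ^ (b + x) * real a * real b ^ 3)"
  have pos: "0 < d" "0 < n div d" if "d dvd n" for d
    using that n by (auto elim: dvdE)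
  have S: "S = C + F"
    unfolding S_def C_def F_def by (rule sum_sols_split)
  have B: "B = A - 8 * C"
  proof -
    have "B = (\<Sum>(a, b, x, y) \<in> {(a, b, x, y) \<in> sols n. b < a}. weight (a - b) b x (x + y))"
      unfolding B_def by (rule sum_sols_shear)
    also have "\<dots> = (\<Sum>(a, b, x, y) \<in> {(a, b, x, y) \<in> sols n. b < a}. weight a b x y -
      8 * ((-1) ^ (b + x) * real a * real b ^ 3 + (-1) ^ (a + y) * real b * real a ^ 3))"
      by (rule sum.cong) (auto simp: weight_shear)
    also have "\<dots> = A - 8 * C"
      unfolding A_def C_def by (simp add: case_prod_unfold sum_subtractf sum_distrib_left)
    finally show ?thesis .
  qed
  \<comment> \<open>Both sides are the full sum of \<open>weight\<close>, split by comparing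
    \<open>a\<close> with \<open>b\<close> on the left and \<open>x\<close> with \<open>y\<close> on
    the right; exchange symmetry doubles the off-diagonal halves.\<close>
  have ABDE: "2 * A + D = 2 * B + E"
  proof -
    have "2 * A + D = (\<Sum>(a, b, x, y) \<in> sols n. weight a b x y)"
      unfolding A_def D_def sum_sols_split[where f = weight]
      by (simp add: weight_exchange sum_distrib_left case_prod_unfold)
    also have "\<dots> = (\<Sum>(a, b, x, y) \<in> sols n. weight x y a b)"
      using sum_sols_transpose[where P = "\<lambda>_ _ _ _. True" and f = weight and n = n] by simp
    also have "\<dots> = 2 * (\<Sum>(a, b, x, y) \<in> {(a, b, x, y) \<in> sols n. b < a}. weight x y a b)
        + (\<Sum>(a, b, x, y) \<in> {(a, b, x, y) \<in> sols n. a = b}. weight x y a b)"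
      unfolding sum_sols_split[where f = "\<lambda>a b x y. weight x y a b"]
      by (simp add: weight_exchange sum_distrib_left case_prod_unfold)
    also have "(\<Sum>(a, b, x, y) \<in> {(a, b, x, y) \<in> sols n. b < a}. weight x y a b) =
        (\<Sum>(a, b, x, y) \<in> {(a, b, x, y) \<in> sols n. a < b}. weight y x b a)"
      by (rule sum_sols_exchange)
    also have "\<dots> = B"
      unfolding B_def sum_sols_transpose[where P = "\<lambda>a b x y. x < y"] by (simp add: weight_exchange)
    also have "(\<Sum>(a, b, x, y) \<in> {(a, b, x, y) \<in> sols n. a = b}. weight x y a b) = E"
      unfolding E_def by (rule sum_sols_transpose)
    finally show ?thesis .
  qed
  have F: "F = (\<Sum>d | d dvd n. (-1) ^ d * real d ^ 4 * (- (1 + (-1) ^ (n div d)) / 2))"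
  proof -
    have "F = (\<Sum>d | d dvd n. \<Sum>x = 1..<n div d. (-1) ^ (d + x) * real d * real d ^ 3)"
      unfolding F_def by (rule sum_sols_diag[OF n])
    also have "\<dots> = (\<Sum>d | d dvd n. (-1) ^ d * real d ^ 4 * (\<Sum>x = 1..<n div d. (-1) ^ x))"
      by (simp add: power_add sum_distrib_left power4_eq_xxxx power3_eq_cube mult_ac)
    also have "\<dots> = (\<Sum>d | d dvd n. (-1) ^ d * real d ^ 4 * (- (1 + (-1) ^ (n div d)) / 2))"
      using pos by (intro sum.cong refl arg_cong2[where f = "(*)"] sum_alternating) auto
    finally show ?thesis .
  qed
  \<comment> \<open>At \<open>a = b\<close> the third term of \<open>weight\<close> vanishes and the
    other two have coefficient \<open>(3 * a^2)^2 = 9 * a^4\<close>.\<close>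
  have D: "D = 18 * F"
  proof -
    have "D = (\<Sum>(a, b, x, y) \<in> {(a, b, x, y) \<in> sols n. a = b}.
        9 * ((-1) ^ (b + x) * real a * real b ^ 3)) +
        (\<Sum>(a, b, x, y) \<in> {(a, b, x, y) \<in> sols n. a = b}.
        9 * ((-1) ^ (a + y) * real b * real a ^ 3))"
      unfolding D_def sum.distrib[symmetric]
      by (rule sum.cong)
        (auto simp: weight_def power2_eq_square power3_eq_cube algebra_simps)
    also have "(\<Sum>(a, b, x, y) \<in> {(a, b, x, y) \<in> sols n. a = b}.
        9 * ((-1) ^ (a + y) * real b * real a ^ 3)) =
        (\<Sum>(a, b, x, y) \<in> {(a, b, x, y) \<in> sols n. b = a}.
        9 * ((-1) ^ (b + x) * real a * real b ^ 3))"
      by (rule sum_sols_exchange)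
    also have "\<dots> = 9 * F"
      unfolding F_def by (simp add: sum_distrib_left case_prod_unfold eq_commute)
    also have "(\<Sum>(a, b, x, y) \<in> {(a, b, x, y) \<in> sols n. a = b}.
        9 * ((-1) ^ (b + x) * real a * real b ^ 3)) = 9 * F"
      unfolding F_def by (simp add: sum_distrib_left case_prod_unfold)
    finally show ?thesis by simp
  qed
  have E: "E = (\<Sum>d | d dvd n. - ((-1) ^ (n div d)) * (real d + (-1) ^ d * real d ^ 4)
      + (-1) ^ d * real d ^ 3 * (real d - 1) * (real d - 2) / 3)"
  proof -
    have "E = (\<Sum>(a, b, x, y) \<in> {(a, b, x, y) \<in> sols n. a = b}. weight x y a b)"
      unfolding E_def by (rule sum_sols_transpose)
    also have "\<dots> = (\<Sum>e | e dvd n. \<Sum>a = 1..<n div e. weight a (n div e - a) e e)"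
      by (rule sum_sols_diag[OF n])
    \<comment> \<open>Passing to the codivisor makes \<open>d = a + b\<close> the outer variable,
      with \<open>x = y = n div d\<close>.\<close>
    also have "\<dots> = (\<Sum>d | d dvd n. \<Sum>a = 1..<d. weight a (d - a) (n div d) (n div d))"
      by (rule sum.reindex_bij_witness[where i = "\<lambda>d. n div d" and j = "\<lambda>d. n div d"])
        (use n in \<open>auto elim: dvdE\<close>)
    also have "\<dots> = (\<Sum>d | d dvd n. - ((-1) ^ (n div d)) * (real d + (-1) ^ d * real d ^ 4)
      + (-1) ^ d * real d ^ 3 * (real d - 1) * (real d - 2) / 3)"
    proof (rule sum.cong[OF refl])
      fix d assume "d \<in> {d. d dvd n}"
      then have d: "0 < d" using pos by auto
      let ?e = "n div d"
      let ?q = "\<lambda>b. (-1) ^ b * real b ^ 2 * (2 * real d - real b) ^ 2"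
      have "(\<Sum>a = 1..<d. weight a (d - a) ?e ?e) = (\<Sum>a = 1..<d. (-1) ^ ?e * ?q (d - a)
          + (-1) ^ ?e * ?q a + (-1) ^ d * real d ^ 2 * (real d - 2 * real a) ^ 2)"
      proof (rule sum.cong[OF refl])
        fix a assume "a \<in> {1..<d}"
        then obtain b where b: "d = a + b" using le_Suc_ex by (metis atLeastLessThan_iff less_imp_le)
        show "weight a (d - a) ?e ?e = (-1) ^ ?e * ?q (d - a)
          + (-1) ^ ?e * ?q a + (-1) ^ d * real d ^ 2 * (real d - 2 * real a) ^ 2"
          unfolding weight_def b
          by (simp add: power_add power_mult_distrib algebra_simps flip: power2_eq_square)
            (simp add: power2_eq_square algebra_simps)
      qed
      also have "\<dots> = (-1) ^ ?e * (\<Sum>a = 1..<d. ?q (d - a)) + (-1) ^ ?e * (\<Sum>a = 1..<d. ?q a)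
          + (-1) ^ d * real d ^ 2 * (\<Sum>a = 1..<d. (real d - 2 * real a) ^ 2)"
        by (simp add: sum.distrib sum_distrib_left mult.assoc)
      also have "(\<Sum>a = 1..<d. ?q (d - a)) = (\<Sum>a = 1..<d. ?q a)"
        by (rule sum.reindex_bij_witness[where i = "\<lambda>a. d - a" and j = "\<lambda>a. d - a"]) auto
      finally show "(\<Sum>a = 1..<d. weight a (d - a) ?e ?e) =
          - ((-1) ^ ?e) * (real d + (-1) ^ d * real d ^ 4)
          + (-1) ^ d * real d ^ 3 * (real d - 1) * (real d - 2) / 3"
        unfolding sum_alternating_quartic[OF d] sum_square_centred[OF d]
        by (simp add: field_simps power2_eq_square power3_eq_cube)
    qed
    finally show ?thesis .
  qed
  \<comment> \<open>Since \<open>8 * C = A - B\<close>, the comparison gives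
    \<open>16 * C = E - D = E - 18 * F\<close>, and \<open>S = C + F\<close>.\<close>
  have "16 * S = E - 2 * F"
    using S B ABDE D by linarith
  also have "\<dots> = (\<Sum>d | d dvd n. (-1) ^ d * real d ^ 5 / 3 + 2 * (-1) ^ d * real d ^ 3 / 3
      - (-1) ^ (n div d) * real d)"
    \<comment> \<open>All terms in \<open>d^4\<close>, with either sign character, cancel between
      \<open>E\<close> and \<open>- 2 * F\<close>.\<close>
    unfolding E F sum_distrib_left sum_subtractf[symmetric]
    by (rule sum.cong) (auto simp: field_simps eval_nat_numeral)
  finally show ?thesis unfolding S_def .
qed

section \<open>The convolution with its boundary terms\<close>

lemma minus_one_power_pred: "(-1 :: real) ^ (d - 1) = - ((-1) ^ d)" if "0 < d"
  using that by (cases d) auto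

theorem theorem3p1:
  fixes n :: nat
  shows "((sigma_tilde 5)(0 := 1/8)) n =
    - 48 * (\<Sum>(i, j) \<in> {(i, j). i + j = n}.
      ((sigma_hat 1)(0 := 1/24)) i * ((sigma_tilde 3)(0 := - 1/16)) j)"
proof (cases "n = 0")
  case True
  have "{(i, j). i + j = (0 :: nat)} = {(0, 0)}" by auto
  with True show ?thesis by simp
next
  case False
  then have n: "0 < n" by simp
  let ?h = "(sigma_hat 1)(0 := 1/24)" and ?t = "(sigma_tilde 3)(0 := - 1/16)"
  let ?I = "{(i, j). i + j = n \<and> 0 < i \<and> 0 < j}"
  have pos: "0 < d" "0 < n div d" if "d dvd n" for d
    using that n by (auto elim: dvdE)
  have "finite ?I"
    by (rule finite_subset[of _ "{..n} \<times> {..n}"]) auto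
  moreover have "{(i, j). i + j = n} = insert (0, n) (insert (n, 0) ?I)"
    by auto
  \<comment> \<open>The two terms with an index 0 are split off; the assigned values 1/24 and -1/16
    are what later cancels \<open>sigma_tilde 3 n\<close> and \<open>sigma_hat 1 n\<close>.\<close>
  ultimately have "(\<Sum>(i, j) \<in> {(i, j). i + j = n}. ?h i * ?t j) =
      sigma_tilde 3 n / 24 - sigma_hat 1 n / 16 + (\<Sum>(i, j) \<in> ?I. ?h i * ?t j)"
    using n by simp
  also have "(\<Sum>(i, j) \<in> ?I. ?h i * ?t j) = (\<Sum>(i, j) \<in> ?I. sigma_hat 1 i * sigma_tilde 3 j)"
    by (rule sum.cong) auto
  also have "\<dots> = (\<Sum>(a, b, x, y) \<in> sols n. (-1) ^ (x - 1) * real a ^ 1 * ((-1) ^ (b - 1) * real b ^ 3))"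
    unfolding sigma_hat_def sigma_tilde_def by (rule convolution_divisor_sums)
  \<comment> \<open>As \<open>b\<close> and \<open>x\<close> are positive, the two shifted exponents
    each contribute a factor -1, and these cancel.\<close>
  also have "\<dots> = (\<Sum>(a, b, x, y) \<in> sols n. (-1) ^ (b + x) * real a * real b ^ 3)"
    by (rule sum.cong) (auto simp: sols_def minus_one_power_pred power_add simp del: One_nat_def)
  also have "\<dots> = (\<Sum>d | d dvd n. (-1) ^ d * real d ^ 5 / 3 + 2 * (-1) ^ d * real d ^ 3 / 3
      - (-1) ^ (n div d) * real d) / 16"
    using sum_sols_signed_cube[OF n] by simp
  also have "\<dots> = (\<Sum>d | d dvd n. - (1 / 3) * ((-1) ^ (d - 1) * real d ^ 5)
      - (2 / 3) * ((-1) ^ (d - 1) * real d ^ 3) + (-1) ^ (n div d - 1) * real d ^ 1) / 16"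
    using pos by (intro arg_cong2[where f = "(/)"] sum.cong refl)
      (auto simp: minus_one_power_pred simp del: One_nat_def)
  also have "\<dots> = (- (1 / 3) * sigma_tilde 5 n - (2 / 3) * sigma_tilde 3 n + sigma_hat 1 n) / 16"
    unfolding sigma_tilde_def sigma_hat_def sum.distrib sum_subtractf sum_distrib_left ..
  finally have conv: "(\<Sum>(i, j) \<in> {(i, j). i + j = n}. ?h i * ?t j) = - sigma_tilde 5 n / 48"
    by (rule trans) (simp add: field_simps)
  show ?thesis
    unfolding conv using n by simp
qed

end
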